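(* Let $R$ be an abelian ring. Then $R$ is Rickart if and only if $R$ is special almost clean.
   Context: Rings are associative with identity. A ring is abelian if all of its idempotents are central. A ring is right (left) Rickart if the right (left) annihilator of each element is generated, as a right (left) ideal, by an idempotent; it is Rickart if it is both left and right Rickart. An element of a ring is regular if it is neither a left nor a right zero-divisor. A ring $R$ is special almost clean if each $a\in R$ can be written as $a=u+e$ with $u$ a regular element, $e$ an idempotent, and $aR\cap eR=0$. *)

theory Defs
  imports "HOL-Algebra.Ring" "HOL-Algebra.Coset"
begin

(* The HOL-Algebra locale "ring" is associative with identity, not necessarily commutative, and
   admits the zero ring.  For an element a, the right ideal aR is written with the library's
   "a <# carrier R" = {a r | r in R} and the left ideal Ra with "carrier R #> a"; since R has an
   identity these are the right and left ideals generated by a.  (The library's PIdl is Ra, and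
   Idl is the two-sided ideal generated by a set, so neither serves for aR.) *)

context ring
begin

definition idempotent :: "'a \<Rightarrow> bool" where
  "idempotent e \<longleftrightarrow> e \<in> carrier R \<and> e \<otimes> e = e"

definition central :: "'a \<Rightarrow> bool" where
  "central c \<longleftrightarrow> c \<in> carrier R \<and> (\<forall>x\<in>carrier R. c \<otimes> x = x \<otimes> c)"

definition right_annihilator :: "'a \<Rightarrow> 'a set" where
  "right_annihilator a = {x \<in> carrier R. a \<otimes> x = \<zero>}"

definition left_annihilator :: "'a \<Rightarrow> 'a set" where
  "left_annihilator a = {x \<in> carrier R. x \<otimes> a = \<zero>}"

(* Zero itself counts as a zero-divisor on both sides, unless R is the zero ring. *)
definition left_zero_divisor :: "'a \<Rightarrow> bool" where
  "left_zero_divisor a \<longleftrightarrow> a \<in> carrier R \<and> (\<exists>x\<in>carrier R. x \<noteq> \<zero> \<and> a \<otimes> x = \<zero>)"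

definition right_zero_divisor :: "'a \<Rightarrow> bool" where
  "right_zero_divisor a \<longleftrightarrow> a \<in> carrier R \<and> (\<exists>x\<in>carrier R. x \<noteq> \<zero> \<and> x \<otimes> a = \<zero>)"

definition regular :: "'a \<Rightarrow> bool" where
  "regular u \<longleftrightarrow> u \<in> carrier R \<and> \<not> left_zero_divisor u \<and> \<not> right_zero_divisor u"

end

locale abelian_ring = ring +
  assumes idempotent_central: "idempotent e \<Longrightarrow> central e"

locale right_rickart_ring = ring +
  assumes right_rickart:
    "a \<in> carrier R \<Longrightarrow> \<exists>e. idempotent e \<and> right_annihilator a = e <# carrier R"

locale left_rickart_ring = ring +
  assumes left_rickart:
    "a \<in> carrier R \<Longrightarrow> \<exists>e. idempotent e \<and> left_annihilator a = carrier R #> e"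

locale rickart_ring = left_rickart_ring + right_rickart_ring

locale special_almost_clean_ring = ring +
  assumes special_almost_clean:
    "a \<in> carrier R \<Longrightarrow>
      \<exists>u e. regular u \<and> idempotent e \<and> a = u \<oplus> e \<and>
        (a <# carrier R) \<inter> (e <# carrier R) = {\<zero>}"

end

theory Submission
  imports Defs
begin

text \<open>
  Fix an element \<open>a\<close> and an idempotent \<open>e\<close>, which is central because the ring is abelian. The theorem
  rests on a pointwise equivalence: \<open>e\<close> generates both annihilators of \<open>a\<close> if and only if
  \<open>a = (a - e) + e\<close> is a special almost clean decomposition of \<open>a\<close>.

  Since \<open>ae = ea\<close> lies in \<open>aR \<inter> eR\<close>, the intersection is zero exactly when \<open>ae = 0\<close>. Suppose so.
  The ring then splits as \<open>eR \<times> (1 - e)R\<close>; in the first factor \<open>a\<close> is \<open>0\<close> and \<open>a - e\<close> is \<open>-1\<close>, while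
  in the second \<open>a - e\<close> agrees with \<open>a\<close>. So \<open>a - e\<close> is regular if and only if \<open>a\<close> kills nothing but
  \<open>0\<close> in the second factor, from either side, that is, its two annihilators are no larger than the
  ideal generated by \<open>e\<close>. This is \<open>regular_minus_idempotent_iff\<close>, and
  \<open>special_almost_clean_iff_annihilators\<close> combines it with the criterion for the intersection.

  The Rickart condition offers one idempotent for each annihilator. In an abelian ring the two
  coincide, so the equivalence applies.
\<close>

lemma (in ring) right_annihilator_eq_idempotent_iff:
  assumes a: "a \<in> carrier R" and e: "idempotent e"
  shows "right_annihilator a = e <# carrier R \<longleftrightarrow>
    a \<otimes> e = \<zero> \<and> (\<forall>x\<in>carrier R. a \<otimes> x = \<zero> \<longrightarrow> e \<otimes> x = x)"
proof -
  have eR: "e \<in> carrier R" and ee: "e \<otimes> e = e"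
    using e by (auto simp: idempotent_def)
  have mem: "x \<in> e <# carrier R \<longleftrightarrow> x \<in> carrier R \<and> e \<otimes> x = x" for x
    using eR ee by (force simp: l_coset_def m_assoc[symmetric])
  have "right_annihilator a = e <# carrier R \<longleftrightarrow>
      (\<forall>x\<in>carrier R. a \<otimes> x = \<zero> \<longleftrightarrow> e \<otimes> x = x)"
    unfolding set_eq_iff mem right_annihilator_def by auto
  moreover have "a \<otimes> x = \<zero>" if "a \<otimes> e = \<zero>" "x \<in> carrier R" "e \<otimes> x = x" for x
    using that a eR by (metis l_null m_assoc)
  ultimately show ?thesis
    using eR ee by blast
qed

lemma (in ring) left_annihilator_eq_idempotent_iff:
  assumes a: "a \<in> carrier R" and e: "idempotent e"
  shows "left_annihilator a = carrier R #> e \<longleftrightarrow>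
    e \<otimes> a = \<zero> \<and> (\<forall>x\<in>carrier R. x \<otimes> a = \<zero> \<longrightarrow> x \<otimes> e = x)"
proof -
  have eR: "e \<in> carrier R" and ee: "e \<otimes> e = e"
    using e by (auto simp: idempotent_def)
  have mem: "x \<in> carrier R #> e \<longleftrightarrow> x \<in> carrier R \<and> x \<otimes> e = x" for x
    using eR ee by (force simp: r_coset_def m_assoc)
  have "left_annihilator a = carrier R #> e \<longleftrightarrow>
      (\<forall>x\<in>carrier R. x \<otimes> a = \<zero> \<longleftrightarrow> x \<otimes> e = x)"
    unfolding set_eq_iff mem left_annihilator_def by auto
  moreover have "x \<otimes> a = \<zero>" if "e \<otimes> a = \<zero>" "x \<in> carrier R" "x \<otimes> e = x" for x
    using that a eR by (metis r_null m_assoc)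
  ultimately show ?thesis
    using eR ee by blast
qed

lemma (in abelian_ring) idempotent_commutes:
  assumes "idempotent e" "x \<in> carrier R"
  shows "e \<otimes> x = x \<otimes> e"
  using idempotent_central[OF assms(1)] assms(2) by (simp add: central_def)

text \<open>
  The product \<open>ae = ea\<close> is a common element of the two right ideals; conversely, if it vanishes, then
  \<open>e\<close> kills \<open>aR\<close> but fixes every element of \<open>eR\<close>.
\<close>

lemma (in abelian_ring) right_ideals_disjoint_iff:
  assumes a: "a \<in> carrier R" and e: "idempotent e"
  shows "(a <# carrier R) \<inter> (e <# carrier R) = {\<zero>} \<longleftrightarrow> a \<otimes> e = \<zero>"
proof
  have eR: "e \<in> carrier R" and ee: "e \<otimes> e = e"
    using e by (auto simp: idempotent_def)
  have ea: "e \<otimes> a = a \<otimes> e"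
    using idempotent_commutes[OF e a] .
  {
    assume disjoint: "(a <# carrier R) \<inter> (e <# carrier R) = {\<zero>}"
    have "a \<otimes> e \<in> a <# carrier R"
      using eR by (auto simp: l_coset_def)
    moreover have "a \<otimes> e \<in> e <# carrier R"
      unfolding ea[symmetric] using a by (auto simp: l_coset_def)
    ultimately show "a \<otimes> e = \<zero>"
      using disjoint by blast
  next
    assume ae: "a \<otimes> e = \<zero>"
    have "a \<otimes> r = \<zero>" if r: "r \<in> carrier R" and s: "s \<in> carrier R" and eq: "a \<otimes> r = e \<otimes> s" for r s
    proof -
      have "a \<otimes> r = e \<otimes> (e \<otimes> s)"
        using eq eR ee s by (simp add: m_assoc[symmetric])
      also have "\<dots> = (e \<otimes> a) \<otimes> r"
        using eq eR a r by (simp add: m_assoc)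
      finally show ?thesis
        using ea ae r by simp
    qed
    moreover have "\<zero> \<in> b <# carrier R" if "b \<in> carrier R" for b
      using that by (auto simp: l_coset_def intro!: bexI[of _ \<zero>])
    ultimately show "(a <# carrier R) \<inter> (e <# carrier R) = {\<zero>}"
      using a eR by (auto simp: l_coset_def)
  }
qed

lemma (in ring) regular_iff:
  "regular u \<longleftrightarrow> u \<in> carrier R \<and>
    (\<forall>x\<in>carrier R. u \<otimes> x = \<zero> \<longrightarrow> x = \<zero>) \<and> (\<forall>x\<in>carrier R. x \<otimes> u = \<zero> \<longrightarrow> x = \<zero>)"
  by (auto simp: regular_def left_zero_divisor_def right_zero_divisor_def)

text \<open>
  If \<open>ax = 0\<close>, then \<open>a - e\<close> kills the component \<open>x - ex\<close>. Conversely, if \<open>(a - e)x = 0\<close>, then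
  multiplication by \<open>e\<close> yields \<open>ex = 0\<close>, whence \<open>ax = 0\<close>
  and \<open>x = ex = 0\<close> by hypothesis. The other side is symmetric because \<open>e\<close>
  commutes with everything.
\<close>

lemma (in abelian_ring) regular_minus_idempotent_iff:
  assumes a: "a \<in> carrier R" and e: "idempotent e" and ae: "a \<otimes> e = \<zero>"
  shows "regular (a \<ominus> e) \<longleftrightarrow>
    (\<forall>x\<in>carrier R. a \<otimes> x = \<zero> \<longrightarrow> e \<otimes> x = x) \<and>
    (\<forall>x\<in>carrier R. x \<otimes> a = \<zero> \<longrightarrow> x \<otimes> e = x)"
proof -
  have eR: "e \<in> carrier R" and ee: "e \<otimes> e = e"
    using e by (auto simp: idempotent_def)
  have ea: "e \<otimes> a = \<zero>"
    using idempotent_commutes[OF e a] ae by simp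
  have distr_left: "(p \<ominus> q) \<otimes> x = p \<otimes> x \<ominus> q \<otimes> x"
    if "p \<in> carrier R" "q \<in> carrier R" "x \<in> carrier R" for p q x
    using that by (simp add: minus_eq l_distr l_minus)
  have distr_right: "x \<otimes> (p \<ominus> q) = x \<otimes> p \<ominus> x \<otimes> q"
    if "p \<in> carrier R" "q \<in> carrier R" "x \<in> carrier R" for p q x
    using that by (simp add: minus_eq r_distr r_minus)
  have eq_iff: "x \<ominus> y = \<zero> \<longleftrightarrow> x = y" if "x \<in> carrier R" "y \<in> carrier R" for x y
    using that by (metis minus_eq a_inv_closed minus_equality minus_minus r_neg)
  have eeL: "e \<otimes> (e \<otimes> x) = e \<otimes> x" and aeL: "a \<otimes> (e \<otimes> x) = \<zero>" and eaL: "e \<otimes> (a \<otimes> x) = \<zero>"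
    and eeR: "(x \<otimes> e) \<otimes> e = x \<otimes> e" and eaR: "(x \<otimes> e) \<otimes> a = \<zero>" and aeR: "(x \<otimes> a) \<otimes> e = \<zero>"
    if x: "x \<in> carrier R" for x
    using x a eR ee ae ea by (simp_all add: m_assoc[symmetric]) (simp_all add: m_assoc)
  have left: "(\<forall>x\<in>carrier R. (a \<ominus> e) \<otimes> x = \<zero> \<longrightarrow> x = \<zero>) \<longleftrightarrow>
      (\<forall>x\<in>carrier R. a \<otimes> x = \<zero> \<longrightarrow> e \<otimes> x = x)"
  proof (intro iffI ballI impI)
    fix x
    assume cancel: "\<forall>y\<in>carrier R. (a \<ominus> e) \<otimes> y = \<zero> \<longrightarrow> y = \<zero>"
      and x: "x \<in> carrier R" and ax: "a \<otimes> x = \<zero>"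
    have "(a \<ominus> e) \<otimes> (x \<ominus> e \<otimes> x) = \<zero>"
      using x a eR ax by (simp add: distr_left distr_right eeL aeL) (simp add: minus_eq l_neg)
    then have "x \<ominus> e \<otimes> x = \<zero>"
      using cancel x eR by simp
    then show "e \<otimes> x = x"
      using x eR by (simp add: eq_iff)
  next
    fix x
    assume ann: "\<forall>y\<in>carrier R. a \<otimes> y = \<zero> \<longrightarrow> e \<otimes> y = y"
      and x: "x \<in> carrier R" and "(a \<ominus> e) \<otimes> x = \<zero>"
    then have ax: "a \<otimes> x = e \<otimes> x"
      using a eR by (simp add: distr_left eq_iff)
    then have "e \<otimes> x = \<zero>"
      using eaL[OF x] eeL[OF x] by simp
    then show "x = \<zero>"
      using ann x ax by simp
  qed
  have right: "(\<forall>x\<in>carrier R. x \<otimes> (a \<ominus> e) = \<zero> \<longrightarrow> x = \<zero>) \<longleftrightarrow>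
      (\<forall>x\<in>carrier R. x \<otimes> a = \<zero> \<longrightarrow> x \<otimes> e = x)"
  proof (intro iffI ballI impI)
    fix x
    assume cancel: "\<forall>y\<in>carrier R. y \<otimes> (a \<ominus> e) = \<zero> \<longrightarrow> y = \<zero>"
      and x: "x \<in> carrier R" and xa: "x \<otimes> a = \<zero>"
    have "(x \<ominus> x \<otimes> e) \<otimes> (a \<ominus> e) = \<zero>"
      using x a eR xa by (simp add: distr_left distr_right eeR eaR) (simp add: minus_eq r_neg)
    then have "x \<ominus> x \<otimes> e = \<zero>"
      using cancel x eR by simp
    then show "x \<otimes> e = x"
      using x eR by (simp add: eq_iff)
  next
    fix x
    assume ann: "\<forall>y\<in>carrier R. y \<otimes> a = \<zero> \<longrightarrow> y \<otimes> e = y"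
      and x: "x \<in> carrier R" and "x \<otimes> (a \<ominus> e) = \<zero>"
    then have xa: "x \<otimes> a = x \<otimes> e"
      using a eR by (simp add: distr_right eq_iff)
    then have "x \<otimes> e = \<zero>"
      using aeR[OF x] eeR[OF x] by simp
    then show "x = \<zero>"
      using ann x xa by simp
  qed
  show ?thesis
    using a eR by (simp add: regular_iff left right)
qed

lemma (in abelian_ring) special_almost_clean_iff_annihilators:
  assumes a: "a \<in> carrier R" and e: "idempotent e"
  shows "regular (a \<ominus> e) \<and> (a <# carrier R) \<inter> (e <# carrier R) = {\<zero>} \<longleftrightarrow>
    right_annihilator a = e <# carrier R \<and> left_annihilator a = carrier R #> e"
  unfolding right_ideals_disjoint_iff[OF a e] right_annihilator_eq_idempotent_iff[OF a e]
    left_annihilator_eq_idempotent_iff[OF a e] idempotent_commutes[OF e a]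
  using regular_minus_idempotent_iff[OF a e] by blast

text \<open>
  Central idempotents that kill \<open>a\<close> do so from both sides, so each of the two generators lies in the
  ideal generated by the other.
\<close>

lemma (in abelian_ring) annihilator_generators_coincide:
  assumes a: "a \<in> carrier R" and e: "idempotent e" and f: "idempotent f"
    and right: "right_annihilator a = e <# carrier R"
    and left: "left_annihilator a = carrier R #> f"
  shows "e = f"
proof -
  have eR: "e \<in> carrier R" and fR: "f \<in> carrier R"
    using e f by (auto simp: idempotent_def)
  have "a \<otimes> e = \<zero>" and r: "\<And>x. x \<in> carrier R \<Longrightarrow> a \<otimes> x = \<zero> \<Longrightarrow> e \<otimes> x = x"
    using right by (auto simp: right_annihilator_eq_idempotent_iff[OF a e])
  moreover have "f \<otimes> a = \<zero>" and l: "\<And>x. x \<in> carrier R \<Longrightarrow> x \<otimes> a = \<zero> \<Longrightarrow> x \<otimes> f = x"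
    using left by (auto simp: left_annihilator_eq_idempotent_iff[OF a f])
  ultimately have "e \<otimes> f = e" "e \<otimes> f = f"
    using idempotent_commutes[OF e a] idempotent_commutes[OF f a] l[OF eR] r[OF fR] by simp_all
  then show ?thesis
    by simp
qed

theorem theorem3p1:
  fixes R (structure)
  assumes "abelian_ring R"
  shows "rickart_ring R \<longleftrightarrow> special_almost_clean_ring R"
proof
  interpret abelian_ring R by fact
  {
    assume "rickart_ring R"
    then interpret rickart_ring R .
    show "special_almost_clean_ring R"
    proof
      fix a
      assume a: "a \<in> carrier R"
      obtain e where e: "idempotent e" and right: "right_annihilator a = e <# carrier R"
        using right_rickart[OF a] by blast
      obtain f where f: "idempotent f" and left: "left_annihilator a = carrier R #> f"
        using left_rickart[OF a] by blast
      have "e = f"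
        using annihilator_generators_coincide[OF a e f right left] .
      then have "regular (a \<ominus> e) \<and> (a <# carrier R) \<inter> (e <# carrier R) = {\<zero>}"
        using special_almost_clean_iff_annihilators[OF a e] right left by simp
      moreover have "a = (a \<ominus> e) \<oplus> e"
        using a e by (simp add: idempotent_def minus_eq a_assoc l_neg)
      ultimately show "\<exists>u e. regular u \<and> idempotent e \<and> a = u \<oplus> e \<and>
          (a <# carrier R) \<inter> (e <# carrier R) = {\<zero>}"
        using e by blast
    qed
  next
    assume "special_almost_clean_ring R"
    then interpret special_almost_clean_ring R .
    have annihilators: "\<exists>e. idempotent e \<and> right_annihilator a = e <# carrier R \<and>
        left_annihilator a = carrier R #> e" if a: "a \<in> carrier R" for a
    proof -
      obtain u e where u: "regular u" and e: "idempotent e" and sum: "a = u \<oplus> e"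
        and disjoint: "(a <# carrier R) \<inter> (e <# carrier R) = {\<zero>}"
        using special_almost_clean[OF a] by blast
      have "a \<ominus> e = u"
        using u e by (simp add: sum regular_def idempotent_def minus_eq a_assoc r_neg)
      then show ?thesis
        using special_almost_clean_iff_annihilators[OF a e] u e disjoint by blast
    qed
    show "rickart_ring R"
      by unfold_locales (use annihilators in blast)+
  }
qed

end
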